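(* For positive integers $n$ and $k$, the statements \[k\le\left\lfloor n+1-\log_2\bigl(n+1-\log_2(n)\bigr)\right\rfloor\] and \[2^{n+1-k}\ge k\] are equivalent. *)

theory Defs
  imports Complex_Main
begin

end

theory Submission
  imports Defs
begin

text \<open>With \<open>m = n + 1 - k\<close>, the two conditions read \<open>n + 1 - log 2 n \<le> 2 ^ m\<close> and
  \<open>n + 1 - m \<le> 2 ^ m\<close>. They differ only through \<open>log 2 n\<close> versus \<open>m\<close>. If \<open>n \<le> 2 ^ m\<close>, both hold
  when \<open>m > 0\<close> and both fail when \<open>m = 0\<close>. If \<open>n = 2 ^ m + r\<close> with \<open>r > 0\<close>, they become
  \<open>2 ^ (r + 1) \<le> 2 ^ m + r\<close> and \<open>r + 1 \<le> m\<close>, which agree because \<open>r < 2 ^ r\<close>.\<close>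

lemma le_log2_of_nat_iff:
  assumes "n > 0"
  shows "real m \<le> log 2 (real n) \<longleftrightarrow> 2 ^ m \<le> n"
  using assms by (simp add: le_log_iff powr_realpow)

lemma log2_of_nat_less:
  assumes "n > 0"
  shows "log 2 (real n) < real n"
  using le_log2_of_nat_iff[OF assms, of n] less_exp[of n] by linarith

text \<open>For \<open>k = n + 1 - m\<close> the right side is \<open>k \<le> 2 ^ m\<close>, written
  additively to avoid truncated subtraction.\<close>

lemma log2_condition_iff:
  assumes "n > 0"
  shows "real n + 1 - log 2 (real n) \<le> 2 ^ m \<longleftrightarrow> n + 1 \<le> 2 ^ m + m"
proof (cases "n \<le> 2 ^ m")
  case True
  have "n + 1 \<le> 2 ^ m + m" if "m > 0"
    using True that by linarith
  \<comment> \<open>The \<open>+ 1\<close> is absorbed by the logarithm, which is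
    \<open>m \<ge> 1\<close>, if \<open>n = 2 ^ m\<close>, and by integrality if
    \<open>n < 2 ^ m\<close>.\<close>
  moreover have "real n + 1 - log 2 (real n) \<le> 2 ^ m" if "m > 0"
  proof (cases "n = 2 ^ m")
    case True
    then show ?thesis using that by (simp add: log_nat_power)
  next
    case False
    with True have "real (n + 1) \<le> real (2 ^ m)"
      by (intro of_nat_mono) linarith
    moreover have "log 2 (real n) \<ge> 0"
      using assms by simp
    ultimately show ?thesis by simp
  qed
  moreover have ?thesis if "m = 0"
    using that assms log2_of_nat_less[OF assms] by simp
  ultimately show ?thesis by blast
next
  case False
  define r where "r = n - 2 ^ m"
  have n: "n = 2 ^ m + r"
    using False by (simp add: r_def)
  have "real n + 1 - log 2 (real n) \<le> 2 ^ m \<longleftrightarrow> real (r + 1) \<le> log 2 (real n)"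
    by (simp add: n algebra_simps)
  also have "\<dots> \<longleftrightarrow> 2 ^ (r + 1) \<le> n"
    by (rule le_log2_of_nat_iff[OF assms])
  also have "\<dots> \<longleftrightarrow> r + 1 \<le> m"
  proof
    assume "r + 1 \<le> m"
    then have "(2::nat) ^ (r + 1) \<le> 2 ^ m"
      by (intro power_increasing) auto
    then show "2 ^ (r + 1) \<le> n"
      by (simp add: n)
  next
    assume le: "2 ^ (r + 1) \<le> n"
    show "r + 1 \<le> m"
    proof (rule ccontr)
      assume "\<not> r + 1 \<le> m"
      \<comment> \<open>Now \<open>n = 2 ^ m + r < 2 ^ r + 2 ^ r = 2 ^ (r + 1)\<close>, against
        \<open>le\<close>.\<close>
      then have "(2::nat) ^ m \<le> 2 ^ r"
        by (intro power_increasing) auto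
      with le n less_exp[of r] show False by simp
    qed
  qed
  also have "\<dots> \<longleftrightarrow> n + 1 \<le> 2 ^ m + m"
    by (simp add: n)
  finally show ?thesis .
qed

theorem theorem1p1:
  fixes n k :: nat
  assumes "n > 0" and "k > 0"
  shows "int k \<le> \<lfloor>real n + 1 - log 2 (real n + 1 - log 2 (real n))\<rfloor>
    \<longleftrightarrow> (2::real) powi (int n + 1 - int k) \<ge> real k"
proof -
  define y where "y = real n + 1 - log 2 (real n)"
  have y: "y > 1"
    using log2_of_nat_less[OF assms(1)] by (simp add: y_def)
  have lhs: "int k \<le> \<lfloor>real n + 1 - log 2 y\<rfloor> \<longleftrightarrow> log 2 y \<le> real n + 1 - real k"
    by (simp add: le_floor_iff algebra_simps)
  show ?thesis
  proof (cases "k \<le> n + 1")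
    case True
    define m where "m = n + 1 - k"
    have m: "int n + 1 - int k = int m" "real n + 1 - real k = real m" and k: "k + m = n + 1"
      using True by (auto simp: m_def)
    have "log 2 y \<le> real m \<longleftrightarrow> y \<le> 2 ^ m"
      using y by (simp add: log_le_iff powr_realpow)
    also have "\<dots> \<longleftrightarrow> n + 1 \<le> 2 ^ m + m"
      unfolding y_def by (rule log2_condition_iff[OF assms(1)])
    also have "\<dots> \<longleftrightarrow> k \<le> 2 ^ m"
      using k by linarith
    also have "\<dots> \<longleftrightarrow> real k \<le> 2 powi int m"
      by simp
    finally show ?thesis
      using lhs by (simp add: m y_def)
  next
    case False
    \<comment> \<open>Both sides fail: \<open>n + 1 - k\<close> is negative while
      \<open>log 2 y\<close> is positive, and the power is at most 1, below
      \<open>k\<close>.\<close>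
    have "log 2 y > 0"
      using y by simp
    moreover have "(2::real) powi (int n + 1 - int k) \<le> 2 powi 0"
      using False by (intro power_int_increasing) auto
    ultimately show ?thesis
      using lhs False by (simp add: y_def)
  qed
qed

end
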